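(* Let $n,k\ge 0$ and $c\ge1$ be integers and let $S$ be a $(\leq k)$-subdivision of the complete graph $K_n$. If $S$ has an anagram-free colouring with $c$ colours, then \[k\;\ge\;\left(c!\left(\frac{n}{c}-1\right)\right)^{1/c}-c.\]
   Context: An anagram is a word of the form $WP$ where $W$ is a non-empty word and $P$ is a permutation of $W$. A vertex colouring of a graph is anagram-free if the sequence of colours along every path of the graph is not an anagram. A subdivision of $G$ is obtained by replacing each edge $uv$ by a path with endpoints $u,v$; internal vertices are division vertices. A $(\le k)$-subdivision is a subdivision in which every edge receives at most $k$ division vertices. *)

theory Defs
  imports Complex_Main "HOL-Library.Multiset" "HOL-Library.FuncSet" "Graph_Theory.Graph_Theory"
begin

text \<open>
  Finite simple graphs are the loop-free symmetric digraphs without parallel arcs of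
  the locale \<^locale>\<open>graph\<close>, so an edge \<open>uv\<close> appears as the two pairs
  \<open>(u, v)\<close> and \<open>(v, u)\<close> in \<^const>\<open>arcs_ends\<close>. Paths are the
  vertex lists satisfying \<^const>\<open>vpath\<close>; single-vertex paths are included.
\<close>

definition anagram :: "'c list \<Rightarrow> bool" where
  "anagram w \<longleftrightarrow> (\<exists>u p. w = u @ p \<and> u \<noteq> [] \<and> mset p = mset u)"

text \<open>Not every one of the \<open>c\<close> colours has to occur.\<close>

definition anagram_free_colouring ::
    "('a, 'b) pre_digraph \<Rightarrow> nat \<Rightarrow> ('a \<Rightarrow> nat) \<Rightarrow> bool" where
  "anagram_free_colouring S c f \<longleftrightarrow>
     f \<in> verts S \<rightarrow> {..<c} \<and> (\<forall>p. vpath p S \<longrightarrow> \<not> anagram (map f p))"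

definition internal_verts :: "'a list \<Rightarrow> 'a list" where
  "internal_verts p = butlast (tl p)"

text \<open>
  \<open>P (u, v)\<close> is the path of \<open>S\<close>, listed from \<open>u\<close> to \<open>v\<close>, that
  replaces the edge \<open>uv\<close> of \<open>G\<close>; \<open>P (v, u)\<close> is the same path listed
  backwards. An edge that is not divided is replaced by \<open>[u, v]\<close>. The relation
  \<^const>\<open>subdivision\<close> of the library iterates the division of a single arc, and does
  not record which division vertices belong to which edge of \<open>G\<close>.
\<close>

definition subdivision_paths ::
    "('a, 'b) pre_digraph \<Rightarrow> ('a, 'd) pre_digraph \<Rightarrow> ('a \<times> 'a \<Rightarrow> 'a list) \<Rightarrow> bool" where
  "subdivision_paths G S P \<longleftrightarrow>
     graph G \<and> graph S \<and>
     (\<forall>(u, v) \<in> arcs_ends G.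
        vpath (P (u, v)) S \<and> hd (P (u, v)) = u \<and> last (P (u, v)) = v \<and>
        P (v, u) = rev (P (u, v)) \<and>
        set (internal_verts (P (u, v))) \<inter> verts G = {}) \<and>
     (\<forall>(u, v) \<in> arcs_ends G. \<forall>(x, y) \<in> arcs_ends G. {u, v} \<noteq> {x, y} \<longrightarrow>
        set (internal_verts (P (u, v))) \<inter> set (internal_verts (P (x, y))) = {}) \<and>
     verts S = verts G \<union> (\<Union>e \<in> arcs_ends G. set (internal_verts (P e))) \<and>
     arcs_ends S = (\<Union>e \<in> arcs_ends G. set (vwalk_arcs (P e)))"

definition le_subdivision ::
    "nat \<Rightarrow> ('a, 'b) pre_digraph \<Rightarrow> ('a, 'd) pre_digraph \<Rightarrow> bool" where
  "le_subdivision k G S \<longleftrightarrow>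
     (\<exists>P. subdivision_paths G S P \<and>
          (\<forall>e \<in> arcs_ends G. length (internal_verts (P e)) \<le> k))"

end

theory Submission
  imports Defs
begin

text \<open>
  Let \<open>v\<close>, \<open>w\<close>, \<open>w'\<close> be branch vertices of the same colour. If the
  division vertices on the paths from \<open>v\<close> to \<open>w\<close> and from \<open>v\<close> to
  \<open>w'\<close> had the same multiset of colours, then the path from \<open>w\<close> through
  \<open>v\<close> to the last vertex before \<open>w'\<close> would be an anagram. So a colour class of branch
  vertices has at most one element more than there are multisets of size at most \<open>k\<close>
  over \<open>c\<close> colours, of which there are \<open>(k + c) choose c\<close>.
\<close>

text \<open>Stars and bars: the multiplicities of the \<open>c\<close> colours, with the slack up to
  \<open>k\<close> as one more entry, form a list of \<open>c + 1\<close> naturals with sum exactly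
  \<open>k\<close>. An injection into these lists gives both claims.\<close>

lemma finite_card_multisets_size_le:
  fixes c k :: nat
  defines "\<M> \<equiv> {M. set_mset M \<subseteq> {..<c} \<and> size M \<le> k}"
  shows "finite \<M>" "card \<M> \<le> (k + c) choose c"
proof -
  text \<open>The extra last entry pads the sum of the multiplicities to \<open>k\<close>.\<close>
  define g where "g M = map (count M) [0..<c] @ [k - size M]" for M :: "nat multiset"
  define L where "L = {l :: nat list. length l = Suc c \<and> sum_list l = k}"
  have cL: "card L = (k + c) choose c"
    unfolding L_def card_length_sum_list using binomial_symmetric[of k "k + c"] by simp
  then have fL: "finite L"
    by (intro card_ge_0_finite) simp
  have "g M \<in> L" if "M \<in> \<M>" for M
  proof -
    have "size M = (\<Sum>i<c. count M i)"
      using that unfolding \<M>_def size_multiset_overloaded_eq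
      by (intro sum.mono_neutral_left) (auto simp: not_in_iff)
    then have "sum_list (map (count M) [0..<c]) = size M"
      by (simp add: sum_list_sum_nth atLeast0LessThan)
    then show ?thesis
      using that by (simp add: g_def L_def \<M>_def)
  qed
  then have sub: "g ` \<M> \<subseteq> L" by blast
  \<comment> \<open>Colours from \<open>c\<close> on have multiplicity 0 in every member of
    \<open>\<M>\<close>, so the recorded entries determine the multiset.\<close>
  have inj: "inj_on g \<M>"
  proof (rule inj_onI, rule multiset_eqI)
    fix M N i
    assume M: "M \<in> \<M>" and N: "N \<in> \<M>" and eq: "g M = g N"
    show "count M i = count N i"
    proof (cases "i < c")
      case True
      with eq show ?thesis by (auto simp: g_def)
    next
      case False
      with M N have "i \<notin># M" "i \<notin># N" by (auto simp: \<M>_def)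
      then show ?thesis by (simp add: not_in_iff)
    qed
  qed
  show "finite \<M>" using finite_subset[OF sub fL] inj by (simp add: finite_image_iff)
  show "card \<M> \<le> (k + c) choose c" using card_inj_on_le[OF inj sub fL] cL by simp
qed

text \<open>Distinct ends exclude the one-vertex list, whose only vertex the right-hand side would
  list twice.\<close>

lemma eq_hd_internal_verts_last:
  assumes "p \<noteq> []" "hd p \<noteq> last p"
  shows "p = hd p # internal_verts p @ [last p]"
  using assms by (cases p) (auto simp: internal_verts_def split: if_splits)

text \<open>The shared vertex \<open>v\<close> is listed once, and the arc entering it at the
  junction is the last arc of the first walk.\<close>

lemma vwalk_append_Cons:
  assumes "vwalk (p @ [v]) S" "vwalk (v # q) S"
  shows "vwalk (p @ v # q) S"
proof (cases "p = []")
  case False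
  with assms show ?thesis
    by (simp add: vwalk_def vwalk_arcs_append)
qed (use assms in simp)

lemma subdivision_pathsD:
  assumes "subdivision_paths G S P" "(u, v) \<in> arcs_ends G"
  shows "vpath (P (u, v)) S" "P (v, u) = rev (P (u, v))"
    "P (u, v) \<noteq> []" "hd (P (u, v)) = u" "last (P (u, v)) = v"
    "set (internal_verts (P (u, v))) \<inter> verts G = {}"
proof -
  have "\<forall>(u, v) \<in> arcs_ends G.
      vpath (P (u, v)) S \<and> hd (P (u, v)) = u \<and> last (P (u, v)) = v \<and>
      P (v, u) = rev (P (u, v)) \<and> set (internal_verts (P (u, v))) \<inter> verts G = {}"
    using assms(1) unfolding subdivision_paths_def by (elim conjE)
  from bspec[OF this assms(2)]
  show "vpath (P (u, v)) S" "P (v, u) = rev (P (u, v))" "hd (P (u, v)) = u"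
    "last (P (u, v)) = v" "set (internal_verts (P (u, v))) \<inter> verts G = {}"
    unfolding prod.case by blast+
  then show "P (u, v) \<noteq> []" by (simp add: vpath_def vwalk_def)
qed

lemma subdivision_paths_disjoint:
  assumes "subdivision_paths G S P" "(u, v) \<in> arcs_ends G" "(x, y) \<in> arcs_ends G"
    and "{u, v} \<noteq> {x, y}"
  shows "set (internal_verts (P (u, v))) \<inter> set (internal_verts (P (x, y))) = {}"
proof -
  have "\<forall>(u, v) \<in> arcs_ends G. \<forall>(x, y) \<in> arcs_ends G. {u, v} \<noteq> {x, y} \<longrightarrow>
      set (internal_verts (P (u, v))) \<inter> set (internal_verts (P (x, y))) = {}"
    using assms(1) unfolding subdivision_paths_def by (elim conjE)
  from bspec[OF bspec[OF this assms(2), unfolded prod.case] assms(3)] assms(4)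
  show ?thesis by simp
qed

lemma subdivision_paths_verts:
  assumes "subdivision_paths G S P"
  shows "verts S = verts G \<union> (\<Union>e \<in> arcs_ends G. set (internal_verts (P e)))"
  using assms unfolding subdivision_paths_def by (elim conjE)

lemma subdivision_paths_eq:
  assumes "subdivision_paths G S P" "(u, v) \<in> arcs_ends G" "u \<noteq> v"
  shows "P (u, v) = u # internal_verts (P (u, v)) @ [v]"
  using eq_hd_internal_verts_last[of "P (u, v)"] subdivision_pathsD[OF assms(1,2)] assms(3)
  by simp

lemma anagram_free_internal_colours_neq:
  assumes sub: "subdivision_paths G S P"
    and free: "anagram_free_colouring S c f"
    and vw: "(v, w) \<in> arcs_ends G" and vw': "(v, w') \<in> arcs_ends G"
    and neq: "v \<noteq> w" "v \<noteq> w'" "w \<noteq> w'"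
    and col: "f w = f v"
  shows "image_mset f (mset (internal_verts (P (v, w)))) \<noteq>
    image_mset f (mset (internal_verts (P (v, w'))))"
proof
  define I where "I = internal_verts (P (v, w))"
  define J where "J = internal_verts (P (v, w'))"
  assume "image_mset f (mset (internal_verts (P (v, w)))) =
    image_mset f (mset (internal_verts (P (v, w'))))"
  then have eq: "image_mset f (mset I) = image_mset f (mset J)"
    by (simp add: I_def J_def)
  have PI: "P (v, w) = v # I @ [w]" and PJ: "P (v, w') = v # J @ [w']"
    using subdivision_paths_eq[OF sub] vw vw' neq by (simp_all add: I_def J_def)
  have "graph G" using sub by (simp add: subdivision_paths_def)
  then interpret graph G .
  have V: "w \<in> verts G" "v \<in> verts G"
    using vw by (auto simp: adj_in_verts)
  have Pwv: "P (w, v) = w # rev I @ [v]"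
    using subdivision_pathsD(2)[OF sub vw] PI by simp
  have disj_verts: "set I \<inter> verts G = {}" "set J \<inter> verts G = {}"
    using subdivision_pathsD(6)[OF sub] vw vw' by (simp_all add: I_def J_def)
  have "{v, w} \<noteq> {v, w'}" using neq by (simp add: doubleton_eq_iff)
  then have disj: "set I \<inter> set J = {}"
    using subdivision_paths_disjoint[OF sub vw vw'] by (simp add: I_def J_def)
  have pw: "vpath (w # rev I @ [v]) S" "vpath (v # J @ [w']) S"
    using subdivision_pathsD(1)[OF sub graph_symmetric[OF vw]]
      subdivision_pathsD(1)[OF sub vw'] Pwv PJ by simp_all
  \<comment> \<open>Stopping just before \<open>w'\<close> makes each half one branch vertex
    followed by the division vertices of one edge.\<close>
  let ?q = "(w # rev I) @ (v # J)"
  have "vpath ?q S"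
  proof
    show "vwalk ?q S"
      using pw vwalkI_append_l[of "v # J" "[w']" S] vwalk_append_Cons[of "w # rev I" v S J]
      by (simp add: vpath_def)
    \<comment> \<open>Each half inherits distinctness from its path. The halves are disjoint because
      different edges share no division vertex, no division vertex is a branch vertex, and
      \<open>v\<close> is not on the part of the first path before its end.\<close>
    show "distinct ?q"
      using pw V disj disj_verts neq by (auto simp: vpath_def)
  qed
  moreover have "anagram (map f ?q)"
    unfolding anagram_def
    by (rule exI[of _ "map f (w # rev I)"], rule exI[of _ "map f (v # J)"])
      (use eq col in simp)
  ultimately show False using free unfolding anagram_free_colouring_def by blast
qed

lemma card_colour_class_le:
  assumes sub: "subdivision_paths G S P"
    and len: "\<forall>e \<in> arcs_ends G. length (internal_verts (P e)) \<le> k"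
    and free: "anagram_free_colouring S c f"
    and A: "finite A" "\<And>u v. u \<in> A \<Longrightarrow> v \<in> A \<Longrightarrow> u \<noteq> v \<Longrightarrow> (u, v) \<in> arcs_ends G"
      "\<And>v. v \<in> A \<Longrightarrow> f v = i"
  shows "card A \<le> Suc ((k + c) choose c)"
proof (cases "A = {}")
  case False
  then obtain v where v: "v \<in> A" by blast
  \<comment> \<open>No path leads from \<open>v\<close> to itself, so \<open>h\<close> is used on
    \<open>A - {v}\<close> only; the \<open>Suc\<close> in the bound accounts for
    \<open>v\<close>.\<close>
  define h where "h w = image_mset f (mset (internal_verts (P (v, w))))" for w
  have "inj_on h (A - {v})"
  proof (rule inj_onI, rule ccontr)
    fix w w' assume w: "w \<in> A - {v}" "w' \<in> A - {v}" "h w = h w'" "w \<noteq> w'"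
    then have "(v, w) \<in> arcs_ends G" "(v, w') \<in> arcs_ends G" "f w = f v"
      using A(2)[of v w] A(2)[of v w'] A(3)[of w] A(3)[of v] v by auto
    with w show False
      using anagram_free_internal_colours_neq[OF sub free, of v w w'] by (auto simp: h_def)
  qed
  moreover have "h ` (A - {v}) \<subseteq> {M. set_mset M \<subseteq> {..<c} \<and> size M \<le> k}"
  proof
    fix M assume "M \<in> h ` (A - {v})"
    then obtain w where w: "w \<in> A" "w \<noteq> v" "M = h w" by blast
    with A v have e: "(v, w) \<in> arcs_ends G" by metis
    then have "set (internal_verts (P (v, w))) \<subseteq> verts S"
      using subdivision_paths_verts[OF sub] by blast
    then have "set_mset M \<subseteq> {..<c}"
      using free w unfolding anagram_free_colouring_def h_def by auto
    moreover have "size M \<le> k" using len e w by (simp add: h_def)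
    ultimately show "M \<in> {M. set_mset M \<subseteq> {..<c} \<and> size M \<le> k}" by blast
  qed
  ultimately have "card (A - {v}) \<le> (k + c) choose c"
    using card_inj_on_le finite_card_multisets_size_le by (metis (no_types, lifting) le_trans)
  then show ?thesis using A(1) v by (simp add: card_Diff_singleton)
qed simp

text \<open>The branch vertices split into \<open>c\<close> colour classes, some possibly empty, and
  in a complete graph each class is a clique, so the bound for one class applies to all.\<close>

lemma complete_le_subdivision_card_le:
  assumes K: "complete_digraph n K" and S: "le_subdivision k K S"
    and free: "anagram_free_colouring S c f"
  shows "n \<le> c * Suc ((k + c) choose c)"
proof -
  from S obtain P where P: "subdivision_paths K S P"
    "\<forall>e \<in> arcs_ends K. length (internal_verts (P e)) \<le> k"
    by (auto simp: le_subdivision_def)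
  have K': "card (verts K) = n" "arcs_ends K = {(u, v). (u, v) \<in> verts K \<times> verts K \<and> u \<noteq> v}"
    and "graph K"
    using K by (auto simp: complete_digraph_def)
  then interpret graph K by blast
  have "verts K \<subseteq> verts S" using subdivision_paths_verts[OF P(1)] by blast
  then have "verts K = (\<Union>i<c. {v \<in> verts K. f v = i})"
    using free by (auto simp: anagram_free_colouring_def)
  then have "n \<le> (\<Sum>i<c. card {v \<in> verts K. f v = i})"
    using card_UN_le[of "{..<c}" "\<lambda>i. {v \<in> verts K. f v = i}"] K'(1) by simp
  also have "\<dots> \<le> (\<Sum>i<c. Suc ((k + c) choose c))"
    by (intro sum_mono card_colour_class_le[OF P free]) (auto simp: K'(2))
  finally show ?thesis by simp
qed

theorem theorem8:
  fixes n k c :: nat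
    and K :: "('a, 'b) pre_digraph"
    and S :: "('a, 'd) pre_digraph"
  assumes "c \<ge> 1"
    and "complete_digraph n K"
    and "le_subdivision k K S"
    and "\<exists>f. anagram_free_colouring S c f"
  shows "real k \<ge> root c (fact c * (real n / real c - 1)) - real c"
proof -
  have "n \<le> c * Suc ((k + c) choose c)"
    using complete_le_subdivision_card_le assms(2-4) by blast
  then have "real n \<le> real c * (real ((k + c) choose c) + 1)"
    by (metis of_nat_Suc of_nat_le_iff of_nat_mult add.commute)
  then have "real n / real c - 1 \<le> real ((k + c) choose c)"
    using assms(1) by (simp add: field_simps)
  then have "fact c * (real n / real c - 1) \<le> fact c * real ((k + c) choose c)"
    by (intro mult_left_mono) auto
  also have "\<dots> = real (((k + c) choose c) * fact c)"
    by simp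
  \<comment> \<open>The left side is a product of \<open>c\<close> consecutive integers, the largest
    being \<open>k + c\<close>.\<close>
  also have "\<dots> \<le> real ((k + c) ^ c)"
    using binomial_fact_pow of_nat_le_iff by blast
  \<comment> \<open>For \<open>n < c\<close> the radicand is negative. For \<open>c \<ge> 1\<close>
    the function \<open>root c\<close> is increasing on all reals, with
    \<open>root c (- x) = - root c x\<close>, so no case distinction arises.\<close>
  finally have "root c (fact c * (real n / real c - 1)) \<le> root c (real (k + c) ^ c)"
    using assms(1) by simp
  also have "\<dots> = real (k + c)"
    using assms(1) by (simp add: real_root_power_cancel)
  finally show ?thesis by simp
qed

end
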